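(* Let $T$ be a tree of order $n$ and diameter $\delta$. Then $$\kappa(T)\leq n\delta-\frac{\delta^2}{2}.$$
   Context: All graphs are finite, simple and undirected. The order of a graph is its number of vertices. For a connected graph $G$ on vertices $1,\dots,n$ with $n\ge 2$, adjacency matrix $A$ and diagonal degree matrix $D$, consider the random walk on $G$ with transition matrix $D^{-1}A$. Let $\mathbf{w}=(w_j)$ be its unique stationary distribution ($\mathbf{w}^TD^{-1}A=\mathbf{w}^T$, positive entries summing to $1$), and let $m_{ij}$ be the expected value of the smallest $s\geq 1$ such that the walk started at $i$ is at $j$ at time $s$ (so $m_{ii}$ is the mean return time). Kemeny's constant of $G$ is $\kappa(G)=\sum_{j=1}^n m_{ij}w_j-1$, which does not depend on $i$. By convention, Kemeny's constant of the one-vertex tree is $0$. *)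

theory Defs
  imports "HOL-Probability.Probability" "Graph_Theory.Digraph_Component"
begin

text \<open>Finite simple undirected graphs are the symmetric, loopfree digraphs without parallel arcs
  of the locale \<^locale>\<open>Digraph.graph\<close>. An edge is a pair of opposite arcs, so a closed walk
  that runs along an edge and back is a \<^const>\<open>pre_digraph.cycle\<close> of length 2, and
  \<^const>\<open>Digraph_Component.tree\<close> is false for every symmetric digraph with an arc. The cycles of
  the undirected graph are those of length at least 3.\<close>

definition undirected_tree :: "('a, 'b) pre_digraph \<Rightarrow> bool" where
  "undirected_tree G \<longleftrightarrow>
     Digraph.graph G \<and> Digraph_Component.connected G \<and>
     \<not> (\<exists>p. pre_digraph.cycle G p \<and> 3 \<le> length p)"

definition graph_dist :: "('a, 'b) pre_digraph \<Rightarrow> 'a \<Rightarrow> 'a \<Rightarrow> nat" where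
  "graph_dist G u v = (LEAST k. \<exists>p. pre_digraph.awalk G u p v \<and> length p = k)"

definition graph_diameter :: "('a, 'b) pre_digraph \<Rightarrow> nat" where
  "graph_diameter G = Max {graph_dist G u v | u v. u \<in> verts G \<and> v \<in> verts G}"

definition adjacency :: "('a, 'b) pre_digraph \<Rightarrow> 'a \<Rightarrow> 'a \<Rightarrow> real" where
  "adjacency G u v = (if (u, v) \<in> arcs_ends G then 1 else 0)"

text \<open>The entries of \<open>D\<^sup>-\<^sup>1 A\<close>.\<close>

definition transition :: "('a, 'b) pre_digraph \<Rightarrow> 'a \<Rightarrow> 'a \<Rightarrow> real" where
  "transition G u v = adjacency G u v / real (out_degree G u)"

text \<open>Entries outside the vertex set are pinned to 0, so that \<open>w\<close> is unique as a function.\<close>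

definition is_stationary :: "('a, 'b) pre_digraph \<Rightarrow> ('a \<Rightarrow> real) \<Rightarrow> bool" where
  "is_stationary G w \<longleftrightarrow>
     (\<forall>j\<in>verts G. (\<Sum>i\<in>verts G. w i * transition G i j) = w j) \<and>
     (\<forall>j\<in>verts G. 0 < w j) \<and> (\<Sum>j\<in>verts G. w j) = 1 \<and> (\<forall>j. j \<notin> verts G \<longrightarrow> w j = 0)"

definition stationary :: "('a, 'b) pre_digraph \<Rightarrow> 'a \<Rightarrow> real" where
  "stationary G = (THE w. is_stationary G w)"

text \<open>The law of the walk is the measure on trajectories given by the Ionescu-Tulcea theorem:
  the walk is at \<open>i\<close> at time 0, and \<open>walk_kernel G i n \<omega>\<close> is the law of its position at time \<open>n\<close>
  given its positions \<open>\<omega> 0, \<dots>, \<omega> (n - 1)\<close> before that. Rows of \<open>transition G\<close> that are not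
  probability vectors (isolated vertices, points outside the graph) make \<open>step_pmf\<close> unspecified;
  a walk in a connected graph with at least two vertices never meets them.\<close>

definition step_pmf :: "('a, 'b) pre_digraph \<Rightarrow> 'a \<Rightarrow> 'a pmf" where
  "step_pmf G u = embed_pmf (transition G u)"

definition walk_kernel :: "('a, 'b) pre_digraph \<Rightarrow> 'a \<Rightarrow> nat \<Rightarrow> (nat \<Rightarrow> 'a) \<Rightarrow> 'a measure" where
  "walk_kernel G i n \<omega> =
     measure_pmf (case n of 0 \<Rightarrow> return_pmf i | Suc k \<Rightarrow> step_pmf G (\<omega> k))"

definition walk_measure :: "('a, 'b) pre_digraph \<Rightarrow> 'a \<Rightarrow> (nat \<Rightarrow> 'a) measure" where
  "walk_measure G i =
     projective_family.lim UNIV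
       (Ionescu_Tulcea.CI (walk_kernel G i) (\<lambda>_. count_space UNIV)) (\<lambda>_. count_space UNIV)"

text \<open>The infimum is \<open>\<infinity>\<close> on trajectories that never reach \<open>j\<close>.\<close>

definition hitting_time :: "'a \<Rightarrow> (nat \<Rightarrow> 'a) \<Rightarrow> ennreal" where
  "hitting_time j \<omega> = (INF s\<in>{s. 1 \<le> s \<and> \<omega> s = j}. of_nat s)"

definition mean_hitting_time :: "('a, 'b) pre_digraph \<Rightarrow> 'a \<Rightarrow> 'a \<Rightarrow> ennreal" where
  "mean_hitting_time G i j = (\<integral>\<^sup>+ \<omega>. hitting_time j \<omega> \<partial>walk_measure G i)"

text \<open>Extended real valued, because the mean hitting times are; the value is common to all
  starting vertices \<open>i\<close>.\<close>

definition kemeny :: "('a, 'b) pre_digraph \<Rightarrow> ereal" where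
  "kemeny G =
     (if card (verts G) = 1 then 0
      else THE k. \<forall>i\<in>verts G.
        k = enn2ereal (\<Sum>j\<in>verts G. mean_hitting_time G i j * ennreal (stationary G j)) - 1)"

lemma pmf_step_pmf:
  assumes "Digraph.graph G" and "u \<in> verts G" and "out_degree G u \<noteq> 0"
  shows "pmf (step_pmf G u) v = transition G u v"
proof -
  interpret Digraph.graph G by fact
  let ?N = "{v. (u, v) \<in> arcs_ends G}"
  have img: "?N = head G ` out_arcs G u"
    by (auto simp: arcs_ends_conv)
  have inj: "inj_on (head G) (out_arcs G u)"
    by (intro inj_onI no_multi_arcs) (auto simp: arc_to_ends_def)
  have fin: "finite ?N" and cd: "card ?N = out_degree G u"
    unfolding img using inj by (auto simp: out_degree_def card_image)
  have "(\<integral>\<^sup>+x. ennreal (transition G u x) \<partial>count_space UNIV)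
      = (\<integral>\<^sup>+x. ennreal (1 / real (out_degree G u)) * indicator ?N x \<partial>count_space UNIV)"
    by (intro nn_integral_cong) (auto simp: transition_def adjacency_def indicator_def)
  also have "\<dots> = ennreal (1 / real (out_degree G u)) * of_nat (card ?N)"
    using fin by (subst nn_integral_cmult_indicator) auto
  also have "\<dots> = 1"
    using assms(3) unfolding cd ennreal_of_nat_eq_real_of_nat by (subst ennreal_mult[symmetric]) auto
  finally show ?thesis
    unfolding step_pmf_def by (intro pmf_embed_pmf) (auto simp: transition_def adjacency_def)
qed

lemma Ionescu_Tulcea_walk: "Ionescu_Tulcea (walk_kernel G i) (\<lambda>_. count_space UNIV)"
proof (rule Ionescu_Tulcea.intro)
  fix n :: nat
  show "walk_kernel G i n \<in> measurable (PiM {0..<n} (\<lambda>_. count_space UNIV))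
      (subprob_algebra (count_space UNIV))"
  proof (cases n)
    case (Suc k)
    have "(\<lambda>\<omega>. measure_pmf (step_pmf G (\<omega> k))) \<in> measurable (PiM {0..<n} (\<lambda>_. count_space UNIV))
      (subprob_algebra (count_space UNIV))"
      by (rule measurable_compose[OF measurable_component_singleton[of k]])
        (auto simp: Suc space_subprob_algebra intro: measure_pmf.subprob_space_axioms)
    then show ?thesis by (simp add: Suc walk_kernel_def[abs_def])
  qed (auto simp: walk_kernel_def[abs_def] space_subprob_algebra
         intro: measure_pmf.subprob_space_axioms)
qed (simp add: walk_kernel_def measure_pmf.prob_space_axioms)

lemma sets_walk_measure: "sets (walk_measure G i) = sets (PiM UNIV (\<lambda>_. count_space UNIV))"
proof -
  interpret Ionescu_Tulcea "walk_kernel G i" "\<lambda>_. count_space UNIV"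
    by (rule Ionescu_Tulcea_walk)
  show ?thesis unfolding walk_measure_def by simp
qed

lemma measurable_hitting_time: "hitting_time j \<in> borel_measurable (walk_measure G i)"
proof -
  have [measurable]: "(\<lambda>\<omega>. \<omega> s) \<in> measurable (PiM UNIV (\<lambda>_. count_space UNIV)) (count_space UNIV)"
    for s :: nat by (rule measurable_component_singleton) simp
  have eq: "hitting_time j \<omega> = (INF s. if 1 \<le> s \<and> \<omega> s = j then of_nat s else \<infinity>)" for \<omega>
  proof (rule antisym)
    show "hitting_time j \<omega> \<le> (INF s. if 1 \<le> s \<and> \<omega> s = j then of_nat s else \<infinity>)"
      unfolding hitting_time_def by (intro INF_greatest) (auto intro: INF_lower)
    show "(INF s. if 1 \<le> s \<and> \<omega> s = j then of_nat s else \<infinity>) \<le> hitting_time j \<omega>"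
      unfolding hitting_time_def
    proof (intro INF_greatest)
      fix s assume "s \<in> {s. 1 \<le> s \<and> \<omega> s = j}"
      then show "(INF s. if 1 \<le> s \<and> \<omega> s = j then of_nat s else \<infinity>) \<le> (of_nat s :: ennreal)"
        by (intro INF_lower2[of s]) auto
    qed
  qed
  show ?thesis
    unfolding eq[abs_def] measurable_cong_sets[OF sets_walk_measure refl] by measurable
qed

lemma emeasure_walk_cylinder:
  "emeasure (walk_measure G i) {\<omega>. \<forall>k\<le>n. \<omega> k = x k}
     = (if x 0 = i then (\<Prod>k<n. ennreal (pmf (step_pmf G (x k)) (x (Suc k)))) else 0)"
proof -
  interpret Ionescu_Tulcea "walk_kernel G i" "\<lambda>_. count_space UNIV"
    by (rule Ionescu_Tulcea_walk)
  let ?M = "\<lambda>_::nat. count_space (UNIV::'a set)"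
  let ?r = "\<lambda>m. restrict x {0..<m}"
  have X: "{?r m} \<in> sets (PiM {0..<m} ?M)" for m
  proof -
    have "(PiE {0..<m} (\<lambda>k. {x k})) \<in> sets (PiM {0..<m} ?M)"
      by (intro sets_PiM_I_finite) auto
    moreover have "PiE {0..<m} (\<lambda>k. {x k}) = {?r m}"
      by (auto simp: PiE_iff extensional_def restrict_def fun_eq_iff)
    ultimately show ?thesis by simp
  qed
  have C: "emeasure (C 0 m (\<lambda>_. undefined)) {?r m}
      = (\<Prod>k<m. emeasure (walk_kernel G i k (?r k)) {x k})" for m
  proof (induction m)
    case 0
    then show ?case using X[of 0] by (auto simp: restrict_def)
  next
    case (Suc m)
    have sp: "(\<lambda>_. undefined) \<in> space (PiM {0..<0::nat} ?M)" by (simp add: space_PiM)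
    have "emeasure (C 0 (Suc m) (\<lambda>_. undefined)) {?r (Suc m)}
        = (\<integral>\<^sup>+\<omega>. emeasure (eP m \<omega>) {?r (Suc m)} \<partial>C 0 m (\<lambda>_. undefined))"
      using measurable_C[of 0 m] space_C[OF sp, of m] sets_C[OF sp, of m]
        measurable_eP[of m] prob_space.not_empty[OF prob_space_C[OF sp, of m]]
      by (simp, subst emeasure_bind[OF _ _ X]) 
        (auto simp: measurable_cong_sets[OF sets_C[OF sp, of m] refl])
    also have "\<dots> = (\<integral>\<^sup>+\<omega>. emeasure (walk_kernel G i m (?r m)) {x m} * indicator {?r m} \<omega>
        \<partial>C 0 m (\<lambda>_. undefined))"
    proof (intro nn_integral_cong)
      fix \<omega> assume "\<omega> \<in> space (C 0 m (\<lambda>_. undefined))"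
      then have w: "\<omega> \<in> space (PiM {0..<m} ?M)" using space_C[OF sp, of m] by simp
      then have ext: "\<omega> k = undefined" if "\<not> k < m" for k
        using that by (auto simp: space_PiM PiE_iff extensional_def)
      have "(fun_upd \<omega> m -` {?r (Suc m)}) = (if \<omega> = ?r m then {x m} else {})"
      proof (cases "\<omega> = ?r m")
        case True
        then show ?thesis
          by (auto simp: fun_eq_iff restrict_def less_Suc_eq split: if_splits)
      next
        case False
        have "fun_upd \<omega> m y \<noteq> ?r (Suc m)" for y
        proof
          assume A: "fun_upd \<omega> m y = ?r (Suc m)"
          have "\<omega> k = ?r m k" for k
            using fun_cong[OF A, of k] ext[of k]
            by (cases "k < m") (auto simp: restrict_def split: if_splits)
          with False show False by auto
        qed
        with False show ?thesis by auto
      qed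
      then show "emeasure (eP m \<omega>) {?r (Suc m)}
          = emeasure (walk_kernel G i m (?r m)) {x m} * indicator {?r m} \<omega>"
        using emeasure_eP[OF w X] by auto
    qed
    also have "\<dots> = emeasure (walk_kernel G i m (?r m)) {x m}
        * emeasure (C 0 m (\<lambda>_. undefined)) {?r m}"
      using X[of m] sets_C[OF sp, of m] by (subst nn_integral_cmult_indicator) auto
    finally show ?case by (simp only: Suc.IH prod.lessThan_Suc mult.commute)
  qed
  have "{\<omega>. \<forall>k\<le>n. \<omega> k = x k} = prod_emb UNIV ?M {0..<Suc n} {?r (Suc n)}"
    by (auto simp: prod_emb_def space_PiM fun_eq_iff restrict_def less_Suc_eq_le) metis
  then have "emeasure (walk_measure G i) {\<omega>. \<forall>k\<le>n. \<omega> k = x k} = emeasure (CI {0..<Suc n}) {?r (Suc n)}"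
    unfolding walk_measure_def using lim[OF _ X[of "Suc n"]] by simp
  also have "\<dots> = emeasure (C 0 (Suc n) (\<lambda>_. undefined)) (prod_emb {0..<Suc n} ?M {0..<Suc n} {?r (Suc n)})"
    by (rule emeasure_CI[OF _ X]) simp
  also have "prod_emb {0..<Suc n} ?M {0..<Suc n} {?r (Suc n)} = {?r (Suc n)}"
    using sets.sets_into_space[OF X[of "Suc n"]] by (intro prod_emb_id) (auto simp: space_PiM)
  finally show ?thesis
    unfolding C prod.lessThan_Suc_shift
    by (auto simp: walk_kernel_def emeasure_pmf_single)
qed

end

theory Submission
  imports Defs
begin

text \<open>
  Kemeny's constant of a graph is the stationary average of the mean hitting times of the other
  vertices, whatever the starting vertex. In a tree with
  degrees \<open>d\<^sub>v\<close> and degree sum \<open>D = \<Sum>\<^sub>v d\<^sub>v = 2 (n - 1)\<close> the hitting times are explicit in terms of the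
  distances,
  \<open>m\<^sub>i\<^sub>j = 1/2 \<Sum>\<^sub>k d\<^sub>k (dist i j + dist j k - dist i k)\<close> for \<open>i \<noteq> j\<close>, and averaging over \<open>j\<close> with the
  stationary weights \<open>d\<^sub>j / D\<close> makes the terms that depend on \<open>i\<close> cancel:
  \<open>\<kappa> = (\<Sum>\<^sub>j\<^sub>,\<^sub>k d\<^sub>j d\<^sub>k dist j k) / (2 D)\<close> (lemma \<open>kemeny_tree\<close>).

  Everything on the graph side comes from one property of trees (\<open>unique_closer_nbr\<close>): seen from a
  vertex \<open>w\<close>, every other vertex has exactly one neighbour that is closer to \<open>w\<close>, and all its
  remaining neighbours are farther away. Two neighbours of \<open>u\<close> that are not farther from \<open>w\<close> than
  \<open>u\<close> would be joined by a path that avoids \<open>u\<close>, and \<open>u\<close> would close it to a cycle. This property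
  evaluates the sum of a function of the distance over the neighbours of a vertex
  (\<open>sum_nbrs_dist\<close>). It verifies the
  first-step equations for the hitting times, and summing it over all vertices gives the degree
  sum and the degree-weighted distance sum \<open>\<Sum>\<^sub>v d\<^sub>v dist v w = 2 \<Sum>\<^sub>v dist v w - (n - 1)\<close>.

  The bound itself (\<open>sum_dist_deficit\<close>) holds for each vertex \<open>i\<close> separately:
  \<open>\<Sum>\<^sub>v\<^sub>\<noteq>\<^sub>i (2 \<delta> + 1 - 2 dist v i) \<ge> \<delta>\<^sup>2\<close>. All summands are positive, so it suffices to add up those on a
  path that realises the diameter and on the path that connects \<open>i\<close> to it; both have enough
  vertices near \<open>i\<close>. Hence \<open>\<Sum>\<^sub>v d\<^sub>v dist v i \<le> 2 \<delta> (n - 1) - \<delta>\<^sup>2\<close> for every \<open>i\<close>, and therefore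
  \<open>\<kappa> \<le> (n - 1) \<delta> - \<delta>\<^sup>2 / 2\<close>, which is stronger than the claim by \<open>\<delta>\<close>.

  On the probabilistic side, the mean hitting time of \<open>j\<close> is the sum over \<open>s\<close> of the probability to
  avoid \<open>j\<close> at the times \<open>1, \<dots>, s\<close>, and any nonnegative solution of the first-step equations on the
  finite graph equals it (\<open>mean_hitting_time_eqI\<close>).
\<close>

section \<open>Neighbours and distances in connected graphs\<close>

definition nbrs :: "('a, 'b) pre_digraph \<Rightarrow> 'a \<Rightarrow> 'a set" where
  "nbrs G u = {v. (u, v) \<in> arcs_ends G}"

context Digraph.graph
begin

lemma nbrs_sym: "v \<in> nbrs G u \<longleftrightarrow> u \<in> nbrs G v"
  using arcs_ends_symmetric[OF sym_arcs] by (auto simp: nbrs_def)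

lemma nbrs_in_verts: "v \<in> nbrs G u \<Longrightarrow> u \<in> verts G \<and> v \<in> verts G"
  by (auto simp: nbrs_def)

lemma not_self_nbr: "u \<notin> nbrs G u"
  by (auto simp: nbrs_def arcs_ends_conv dest: no_loops)

lemma finite_nbrs: "finite (nbrs G u)"
  by (rule finite_subset[OF _ finite_verts]) (auto dest: nbrs_in_verts)

lemma card_nbrs: "card (nbrs G u) = out_degree G u"
proof -
  have "nbrs G u = head G ` out_arcs G u"
    by (auto simp: nbrs_def arcs_ends_conv)
  moreover have "inj_on (head G) (out_arcs G u)"
    by (intro inj_onI no_multi_arcs) (auto simp: arc_to_ends_def)
  ultimately show ?thesis by (simp add: out_degree_def card_image)
qed

end

locale connected_graph = Digraph.graph G for G :: "('a, 'b) pre_digraph" (structure) +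
  assumes connected: "Digraph_Component.connected G"
begin

abbreviation dist_G :: "'a \<Rightarrow> 'a \<Rightarrow> nat" where
  "dist_G \<equiv> graph_dist G"

lemma verts_nonempty: "verts G \<noteq> {}"
  using connected by (auto simp: connected_conv)

lemma awalk_exists:
  assumes "u \<in> verts G" "v \<in> verts G"
  shows "\<exists>p. awalk u p v"
  using symmetric_connected_imp_strongly_connected[OF sym_arcs connected] assms
  by (auto simp: strongly_connected_def reachable_awalk)

lemma awalk_Cons_nbr:
  assumes "v \<in> nbrs G u" "awalk v p w"
  shows "\<exists>e. tail G e = u \<and> head G e = v \<and> awalk u (e # p) w"
  using assms by (auto simp: nbrs_def arcs_ends_conv awalk_Cons_iff)

lemma awalk_reverse:
  assumes "awalk u p v"
  shows "\<exists>q. awalk v q u \<and> length q = length p \<and>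
    set (awalk_verts v q) = set (awalk_verts u p)"
  using assms
proof (induction p arbitrary: u)
  case Nil
  then show ?case by (intro exI[of _ "[]"]) (auto simp: awalk_Nil_iff)
next
  case (Cons e p)
  then have e: "e \<in> arcs G" "u = tail G e" and p: "awalk (head G e) p v"
    by (auto simp: awalk_Cons_iff)
  from Cons.IH[OF p] obtain q where q: "awalk v q (head G e)" "length q = length p"
    "set (awalk_verts v q) = set (awalk_verts (head G e) p)" by blast
  have "u \<in> nbrs G (head G e)"
    using e by (subst nbrs_sym) (auto simp: nbrs_def arcs_ends_conv)
  then obtain e' where e': "e' \<in> arcs G" "tail G e' = head G e" "head G e' = u"
    by (auto simp: nbrs_def arcs_ends_conv)
  have w: "awalk (head G e) [e'] u" using e' by (auto simp: awalk_simps e(2) e(1))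
  have "awalk v (q @ [e']) u" by (rule awalk_appendI[OF q(1) w])
  moreover have "set (awalk_verts v (q @ [e'])) = insert u (set (awalk_verts (head G e) p))"
    using e' hd_in_awalk_verts(1)[OF p] by (auto simp: set_awalk_verts_append[OF q(1) w] q(3))
  ultimately show ?case using q(2) e(2)
    by (intro exI[of _ "q @ [e']"]) auto
qed

lemma shortest_awalk:
  assumes "u \<in> verts G" "v \<in> verts G"
  shows "\<exists>p. awalk u p v \<and> length p = dist_G u v"
  unfolding graph_dist_def using awalk_exists[OF assms]
  by (intro LeastI_ex[of "\<lambda>k. \<exists>p. awalk u p v \<and> length p = k"]) auto

lemma dist_le_length: "awalk u p v \<Longrightarrow> dist_G u v \<le> length p"
  unfolding graph_dist_def by (rule Least_le) auto

lemma dist_self: "u \<in> verts G \<Longrightarrow> dist_G u u = 0"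
  using dist_le_length[of u "[]" u] by (simp add: awalk_Nil_iff)

lemma dist_eq_0_iff:
  assumes "u \<in> verts G" "v \<in> verts G"
  shows "dist_G u v = 0 \<longleftrightarrow> u = v"
  using shortest_awalk[OF assms] dist_self[OF assms(1)] by (auto simp: awalk_Nil_iff)

lemma dist_triangle:
  assumes "u \<in> verts G" "v \<in> verts G" "w \<in> verts G"
  shows "dist_G u w \<le> dist_G u v + dist_G v w"
proof -
  obtain p q where "awalk u p v" "length p = dist_G u v" "awalk v q w" "length q = dist_G v w"
    using shortest_awalk assms by metis
  then show ?thesis using dist_le_length[OF awalk_appendI, of u p v q w] by simp
qed

lemma dist_sym:
  assumes "u \<in> verts G" "v \<in> verts G"
  shows "dist_G u v = dist_G v u"
proof -
  have "dist_G a b \<le> dist_G b a" if "a \<in> verts G" "b \<in> verts G" for a b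
    using shortest_awalk[OF that(2,1)] awalk_reverse dist_le_length by metis
  then show ?thesis using assms by (simp add: antisym)
qed

lemma dist_nbr_le:
  assumes "v \<in> nbrs G u" "w \<in> verts G"
  shows "dist_G u w \<le> Suc (dist_G v w)"
proof -
  obtain p where "awalk v p w" "length p = dist_G v w"
    using shortest_awalk assms nbrs_in_verts by metis
  then show ?thesis
    using awalk_Cons_nbr[OF assms(1)] dist_le_length by (metis length_Cons)
qed

lemma closer_nbr_exists:
  assumes "u \<in> verts G" "w \<in> verts G" "u \<noteq> w"
  shows "\<exists>v\<in>nbrs G u. Suc (dist_G v w) = dist_G u w"
proof -
  obtain p where p: "awalk u p w" "length p = dist_G u w"
    using shortest_awalk assms by metis
  with assms(3) obtain e q where eq: "p = e # q" by (cases p) (auto simp: awalk_Nil_iff)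
  then have e: "e \<in> arcs G" "u = tail G e" "awalk (head G e) q w"
    using p by (auto simp: awalk_Cons_iff)
  then have v: "head G e \<in> nbrs G u" by (auto simp: nbrs_def arcs_ends_conv)
  moreover have "Suc (dist_G (head G e) w) \<le> dist_G u w"
    using dist_le_length[OF e(3)] p(2) eq by simp
  ultimately show ?thesis using dist_nbr_le[OF v assms(2)] by (intro bexI[of _ "head G e"]) auto
qed

text \<open>Shortest paths as sequences of vertices, which makes the distance to the end point available
  along the way.\<close>
lemma geodesic:
  assumes "u \<in> verts G" "w \<in> verts G"
  shows "\<exists>x. x 0 = u \<and> x (dist_G u w) = w \<and>
    (\<forall>l<dist_G u w. x (Suc l) \<in> nbrs G (x l)) \<and>
    (\<forall>l\<le>dist_G u w. x l \<in> verts G \<and> dist_G (x l) w = dist_G u w - l)"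
  using assms(1)
proof (induction "dist_G u w" arbitrary: u)
  case 0
  then have "u = w" using dist_eq_0_iff assms by metis
  then show ?case using 0 assms by (intro exI[of _ "\<lambda>_. u"]) (auto simp: dist_self)
next
  case (Suc m)
  have "u \<noteq> w" using Suc.hyps(2) dist_self[OF Suc.prems] by auto
  then obtain v where v: "v \<in> nbrs G u" "Suc (dist_G v w) = dist_G u w"
    using closer_nbr_exists[OF Suc.prems assms(2)] by blast
  have m: "m = dist_G v w" using v(2) Suc.hyps(2) by simp
  obtain x where x: "x 0 = v" "x m = w" "\<And>l. l < m \<Longrightarrow> x (Suc l) \<in> nbrs G (x l)"
    "\<And>l. l \<le> m \<Longrightarrow> x l \<in> verts G \<and> dist_G (x l) w = m - l"
    using Suc.hyps(1)[OF m] nbrs_in_verts[OF v(1)] unfolding m[symmetric] by blast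
  show ?case unfolding Suc.hyps(2)[symmetric]
    using x v Suc.prems Suc.hyps(2)
    by (intro exI[of _ "\<lambda>l. case l of 0 \<Rightarrow> u | Suc k \<Rightarrow> x k"]) (auto split: nat.split)
qed

lemma sum_nbrs_swap:
  fixes f :: "'a \<Rightarrow> 'a \<Rightarrow> real"
  shows "(\<Sum>u\<in>verts G. \<Sum>v\<in>nbrs G u. f u v) = (\<Sum>v\<in>verts G. \<Sum>u\<in>nbrs G v. f u v)"
proof -
  have "(\<Sum>u\<in>verts G. \<Sum>v\<in>nbrs G u. f u v)
      = (\<Sum>u\<in>verts G. \<Sum>v\<in>verts G. if v \<in> nbrs G u then f u v else 0)"
    by (intro sum.cong refl sum.mono_neutral_cong_left) (auto dest: nbrs_in_verts)
  also have "\<dots> = (\<Sum>v\<in>verts G. \<Sum>u\<in>verts G. if u \<in> nbrs G v then f u v else 0)"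
    by (subst sum.swap) (simp add: nbrs_sym)
  also have "\<dots> = (\<Sum>v\<in>verts G. \<Sum>u\<in>nbrs G v. f u v)"
    by (intro sum.cong refl sum.mono_neutral_cong_right) (auto dest: nbrs_in_verts)
  finally show ?thesis .
qed

lemma handshake:
  fixes f :: "'a \<Rightarrow> real"
  shows "(\<Sum>u\<in>verts G. \<Sum>v\<in>nbrs G u. f v) = (\<Sum>v\<in>verts G. real (out_degree G v) * f v)"
  by (subst sum_nbrs_swap) (simp add: card_nbrs)

lemma graph_diameter_attained:
  "\<exists>u\<in>verts G. \<exists>v\<in>verts G. dist_G u v = graph_diameter G"
  and dist_le_diameter: "a \<in> verts G \<Longrightarrow> b \<in> verts G \<Longrightarrow> dist_G a b \<le> graph_diameter G"
proof -
  let ?S = "{dist_G u v | u v. u \<in> verts G \<and> v \<in> verts G}"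
  have "?S = (\<lambda>(u, v). dist_G u v) ` (verts G \<times> verts G)" by auto
  then have fin: "finite ?S" by simp
  moreover have "?S \<noteq> {}" using verts_nonempty by blast
  ultimately have "Max ?S \<in> ?S" by (rule Max_in)
  then obtain u v where "u \<in> verts G" "v \<in> verts G" "Max ?S = dist_G u v" by blast
  then show "\<exists>u\<in>verts G. \<exists>v\<in>verts G. dist_G u v = graph_diameter G"
    unfolding graph_diameter_def by metis
  show "dist_G a b \<le> graph_diameter G" if "a \<in> verts G" "b \<in> verts G"
    unfolding graph_diameter_def using fin that by (intro Max_ge) auto
qed

end

section \<open>Distances in trees\<close>

locale tree_graph = connected_graph +
  assumes no_long_cycle: "\<not> (\<exists>p. cycle p \<and> 3 \<le> length p)"
begin

text \<open>Shortest walks from \<open>v\<close> and from \<open>v'\<close> to \<open>w\<close> cannot pass through \<open>u\<close>, because \<open>u\<close> is at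
  least as far from \<open>w\<close> as their starting points. If \<open>v \<noteq> v'\<close>, the two walks contain a path from \<open>v\<close>
  to \<open>v'\<close> that avoids \<open>u\<close>, and the edges at \<open>u\<close> turn it into a cycle of length at least 3.\<close>
lemma nonfarther_nbrs_eq:
  assumes "w \<in> verts G" "v \<in> nbrs G u" "v' \<in> nbrs G u"
    and "dist_G v w \<le> dist_G u w" "dist_G v' w \<le> dist_G u w"
  shows "v = v'"
proof (rule ccontr)
  assume ne: "v \<noteq> v'"
  note V = assms(1) nbrs_in_verts[OF assms(2)] nbrs_in_verts[OF assms(3)]
  have avoid: "\<exists>p. awalk a p w \<and> u \<notin> set (awalk_verts a p)"
    if a: "a \<in> nbrs G u" "dist_G a w \<le> dist_G u w" for a
  proof -
    obtain p where p: "awalk a p w" "length p = dist_G a w"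
      using shortest_awalk V nbrs_in_verts[OF a(1)] by metis
    have "u \<notin> set (awalk_verts a p)"
    proof
      assume "u \<in> set (awalk_verts a p)"
      then obtain q r where qr: "p = q @ r" "awalk a q u" "awalk u r w"
        using awalk_decomp[OF p(1)] by blast
      have "q \<noteq> []" using qr(2) a(1) not_self_nbr by (auto simp: awalk_Nil_iff)
      moreover have "dist_G u w \<le> length r" by (rule dist_le_length[OF qr(3)])
      ultimately show False using p(2) a(2) qr(1) by (cases q) auto
    qed
    with p show ?thesis by blast
  qed
  obtain p where p: "awalk v p w" "u \<notin> set (awalk_verts v p)"
    using avoid assms by blast
  obtain p' where p': "awalk v' p' w" "u \<notin> set (awalk_verts v' p')"
    using avoid assms by blast
  obtain q where q: "awalk w q v'" "u \<notin> set (awalk_verts w q)"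
    using awalk_reverse[OF p'(1)] p'(2) by auto
  have pq: "awalk v (p @ q) v'" "u \<notin> set (awalk_verts v (p @ q))"
    using awalk_appendI[OF p(1) q(1)] p(2) q(2) by (auto simp: set_awalk_verts_append[OF p(1) q(1)])
  define r where "r = awalk_to_apath (p @ q)"
  have r: "apath v r v'" unfolding r_def by (rule apath_awalk_to_apath[OF pq(1)])
  have "set r \<subseteq> set (p @ q)" unfolding r_def by (rule awalk_to_apath_subset[OF pq(1)])
  then have ur: "u \<notin> set (awalk_verts v r)"
    using pq(2) set_awalk_verts[OF pq(1)] set_awalk_verts[OF awalkI_apath[OF r]] by auto
  have rne: "r \<noteq> []" using r ne by (auto simp: apath_Nil_iff)
  have "u \<in> nbrs G v'" using assms(3) nbrs_sym by blast
  then obtain e' where e': "e' \<in> arcs G" "tail G e' = v'" "head G e' = u"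
    by (auto simp: nbrs_def arcs_ends_conv)
  have we': "awalk v' [e'] u" using e' V by (auto simp: awalk_simps)
  have wr: "awalk v (r @ [e']) u" by (rule awalk_appendI[OF awalkI_apath[OF r] we'])
  have vr: "awalk_verts v (r @ [e']) = awalk_verts v r @ [u]"
    using awalk_verts_append[OF wr] e' by simp
  obtain e where e: "awalk u (e # r @ [e']) u" "tail G e = u" "head G e = v"
    using awalk_Cons_nbr[OF assms(2) wr] by blast
  have "cycle (e # r @ [e'])"
    unfolding cycle_def using e r ur by (intro exI[of _ u]) (auto simp: vr apath_def)
  moreover have "3 \<le> length (e # r @ [e'])" using rne by (cases r) auto
  ultimately show False using no_long_cycle by blast
qed

lemma unique_closer_nbr:
  assumes "u \<in> verts G" "w \<in> verts G" "u \<noteq> w"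
  obtains v where "v \<in> nbrs G u" "Suc (dist_G v w) = dist_G u w"
    "\<And>v'. v' \<in> nbrs G u \<Longrightarrow> v' \<noteq> v \<Longrightarrow> dist_G v' w = Suc (dist_G u w)"
proof -
  obtain v where v: "v \<in> nbrs G u" "Suc (dist_G v w) = dist_G u w"
    using closer_nbr_exists[OF assms] by blast
  moreover have "dist_G v' w = Suc (dist_G u w)" if "v' \<in> nbrs G u" "v' \<noteq> v" for v'
  proof -
    have "\<not> dist_G v' w \<le> dist_G u w"
      using nonfarther_nbrs_eq[OF assms(2) that(1) v(1)] v(2) that(2) by auto
    moreover have "dist_G v' w \<le> Suc (dist_G u w)"
      using dist_nbr_le[of u v' w] that(1) assms(2) nbrs_sym by blast
    ultimately show ?thesis by simp
  qed
  ultimately show ?thesis using that by blast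
qed

text \<open>The form in which the tree structure enters the degree sums and the first-step equations.\<close>
lemma sum_nbrs_dist:
  fixes g :: "nat \<Rightarrow> real"
  assumes "u \<in> verts G" "w \<in> verts G"
  shows "(\<Sum>v\<in>nbrs G u. g (dist_G v w)) =
    (if u = w then real (out_degree G u) * g 1
     else g (dist_G u w - 1) + (real (out_degree G u) - 1) * g (Suc (dist_G u w)))"
proof (cases "u = w")
  case True
  have "dist_G v w = 1" if "v \<in> nbrs G u" for v
  proof -
    have "dist_G v w \<noteq> 0" using that True not_self_nbr nbrs_in_verts dist_eq_0_iff assms by metis
    moreover have "dist_G v w \<le> Suc (dist_G u w)"
      using dist_nbr_le[of u v w] that assms nbrs_sym by blast
    ultimately show ?thesis using True dist_self assms by simp
  qed
  then show ?thesis using True by (simp add: card_nbrs)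
next
  case False
  obtain v where v: "v \<in> nbrs G u" "Suc (dist_G v w) = dist_G u w"
    "\<And>v'. v' \<in> nbrs G u \<Longrightarrow> v' \<noteq> v \<Longrightarrow> dist_G v' w = Suc (dist_G u w)"
    using unique_closer_nbr[OF assms False] by blast
  have "(\<Sum>v\<in>nbrs G u. g (dist_G v w))
      = g (dist_G v w) + (\<Sum>v'\<in>nbrs G u - {v}. g (dist_G v' w))"
    by (rule sum.remove[OF finite_nbrs v(1)])
  also have "(\<Sum>v'\<in>nbrs G u - {v}. g (dist_G v' w)) = (\<Sum>v'\<in>nbrs G u - {v}. g (Suc (dist_G u w)))"
    using v(3) by (intro sum.cong) auto
  also have "\<dots> = (real (out_degree G u) - 1) * g (Suc (dist_G u w))"
  proof -
    have "0 < card (nbrs G u)" using v(1) finite_nbrs card_gt_0_iff by blast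
    then show ?thesis using v(1) finite_nbrs[of u] card_nbrs[of u] 
      by (simp add: of_nat_diff)
  qed
  finally show ?thesis using False v(2) by (metis diff_Suc_1)
qed

lemma sum_nbrs_dist_eq:
  assumes u: "u \<in> verts G" and w: "w \<in> verts G"
  shows "(\<Sum>v\<in>nbrs G u. real (dist_G v w))
    = real (out_degree G u) * (real (dist_G u w) + 1) - (if u = w then 0 else 2)"
proof -
  have "u \<noteq> w \<Longrightarrow> 1 \<le> dist_G u w" using dist_eq_0_iff[OF u w] by simp
  then show ?thesis
    using sum_nbrs_dist[OF u w, of real] dist_self[OF w] by (auto simp: of_nat_diff algebra_simps)
qed

text \<open>Both of the following identities arise by summing a function of the distance to \<open>w\<close> over
  all arcs. Grouped by heads this is the \<open>handshake\<close> sum; grouped by tails it is evaluated by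
  \<open>sum_nbrs_dist\<close>. The distance itself yields the degree sum, its square the degree-weighted
  distance sum.\<close>
lemma sum_degrees: "(\<Sum>v\<in>verts G. real (out_degree G v)) = 2 * (real (card (verts G)) - 1)"
proof -
  obtain w where w: "w \<in> verts G" using verts_nonempty by blast
  let ?D = "\<lambda>v. real (dist_G v w)" and ?deg = "\<lambda>v. real (out_degree G v)"
  have "(\<Sum>u\<in>verts G. \<Sum>v\<in>nbrs G u. ?D v)
      = (\<Sum>u\<in>verts G. ?deg u * ?D u + ?deg u - (if u = w then 0 else 2))"
    by (intro sum.cong refl) (simp add: sum_nbrs_dist_eq[OF _ w] algebra_simps)
  also have "\<dots> = (\<Sum>u\<in>verts G. ?deg u * ?D u) + (\<Sum>u\<in>verts G. ?deg u) - (\<Sum>u\<in>verts G. if u = w then 0 else 2)"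
    by (simp add: sum.distrib sum_subtractf)
  also have "(\<Sum>u\<in>verts G. if u = w then 0 else 2) = (\<Sum>u\<in>verts G. 2 - (if u = w then 2 else (0::real)))"
    by (intro sum.cong) auto
  also have "\<dots> = 2 * (real (card (verts G)) - 1)"
    using w by (simp add: sum_subtractf)
  finally show ?thesis using handshake[of ?D] by simp
qed

lemma sum_degree_dist:
  assumes w: "w \<in> verts G"
  shows "(\<Sum>v\<in>verts G. real (out_degree G v) * real (dist_G v w))
    = 2 * (\<Sum>v\<in>verts G. real (dist_G v w)) - (real (card (verts G)) - 1)"
proof -
  let ?D = "\<lambda>v. real (dist_G v w)" and ?deg = "\<lambda>v. real (out_degree G v)"
  have "(\<Sum>u\<in>verts G. \<Sum>v\<in>nbrs G u. (?D v)\<^sup>2)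
      = (\<Sum>u\<in>verts G. ?deg u * (?D u)\<^sup>2 + 2 * (?deg u * ?D u) + ?deg u - 4 * ?D u)"
  proof (intro sum.cong refl)
    fix u assume u: "u \<in> verts G"
    have "u \<noteq> w \<Longrightarrow> 1 \<le> dist_G u w" using dist_eq_0_iff[OF u w] by simp
    then show "(\<Sum>v\<in>nbrs G u. (?D v)\<^sup>2) = ?deg u * (?D u)\<^sup>2 + 2 * (?deg u * ?D u) + ?deg u - 4 * ?D u"
      using sum_nbrs_dist[OF u w, of "\<lambda>d. (real d)\<^sup>2"] dist_self[OF w]
      by (auto simp: of_nat_diff algebra_simps power2_eq_square)
  qed
  also have "\<dots> = (\<Sum>u\<in>verts G. ?deg u * (?D u)\<^sup>2) + 2 * (\<Sum>u\<in>verts G. ?deg u * ?D u)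
      + (\<Sum>u\<in>verts G. ?deg u) - 4 * (\<Sum>u\<in>verts G. ?D u)"
    by (simp add: sum.distrib sum_subtractf sum_distrib_left)
  finally show ?thesis using handshake[of "\<lambda>v. (?D v)\<^sup>2"] sum_degrees by simp
qed

end

section \<open>A lower bound for the distance deficit\<close>

text \<open>Once a sequence with steps \<open>\<plusminus>1\<close> and no inner local maximum has moved up, it can never come
  down again.\<close>
lemma no_local_max_imp_V_shape:
  fixes g :: "nat \<Rightarrow> nat"
  assumes "\<And>l. l < m \<Longrightarrow> g (Suc l) = Suc (g l) \<or> g l = Suc (g (Suc l))"
    and "\<And>l. Suc l < m \<Longrightarrow> \<not> (g l < g (Suc l) \<and> g (Suc (Suc l)) < g (Suc l))"
  shows "\<exists>k\<le>m. (\<forall>l\<le>k. g l = g k + (k - l)) \<and> (\<forall>l. k \<le> l \<and> l \<le> m \<longrightarrow> g l = g k + (l - k))"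
  using assms
proof (induction m)
  case 0
  then show ?case by auto
next
  case (Suc m)
  obtain k where k: "k \<le> m" "\<And>l. l \<le> k \<Longrightarrow> g l = g k + (k - l)"
    "\<And>l. k \<le> l \<Longrightarrow> l \<le> m \<Longrightarrow> g l = g k + (l - k)"
    using Suc.IH[OF Suc.prems(1)[OF less_SucI] Suc.prems(2)[OF less_SucI]] by blast
  show ?case
  proof (cases "g (Suc m) = Suc (g m)")
    case True
    have "g l = g k + (l - k)" if "k \<le> l" "l \<le> Suc m" for l
    proof (cases "l = Suc m")
      case l: True
      show ?thesis using True k(3)[of m] k(1) unfolding l by simp
    qed (use k(3)[of l] that in simp)
    then show ?thesis using k(1,2) le_SucI by blast
  next
    case False
    then have down: "g m = Suc (g (Suc m))" using Suc.prems(1)[of m] by auto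
    have km: "k = m"
    proof (rule ccontr)
      assume "k \<noteq> m"
      then obtain l where l: "m = Suc l" "k \<le> l" using k(1) by (cases m) auto
      have "g l < g m" using k(3)[of l] k(3)[of m] l by simp
      then show False using Suc.prems(2)[of l] l(1) down by simp
    qed
    have 1: "g l = g (Suc m) + (Suc m - l)" if "l \<le> Suc m" for l
    proof (cases "l = Suc m")
      case False
      then show ?thesis using that k(2)[of l] down km by simp
    qed simp
    have 2: "g l = g (Suc m) + (l - Suc m)" if "Suc m \<le> l" "l \<le> Suc m" for l
      using le_antisym[OF that] by simp
    show ?thesis using 1 2 by blast
  qed
qed

lemma sum_odd_interval: "(\<Sum>s\<in>{1..m}. b + 1 - 2 * real s) = b * real m - (real m)\<^sup>2"
  by (induction m) (auto simp: algebra_simps power2_eq_square)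

context tree_graph
begin

text \<open>At an inner local maximum of the distance to \<open>i\<close>, both neighbours on the path would be closer
  to \<open>i\<close>, against \<open>nonfarther_nbrs_eq\<close>. The index \<open>k\<close> is the point where the path from \<open>i\<close> meets
  the given one.\<close>
lemma dist_V_shape_on_geodesic:
  assumes i: "i \<in> verts G"
    and nbr: "\<And>l. l < m \<Longrightarrow> x (Suc l) \<in> nbrs G (x l)"
    and inj: "inj_on x {..m}"
  obtains k where "k \<le> m" "\<And>l. l \<le> k \<Longrightarrow> dist_G (x l) i = dist_G (x k) i + (k - l)"
    "\<And>l. k \<le> l \<Longrightarrow> l \<le> m \<Longrightarrow> dist_G (x l) i = dist_G (x k) i + (l - k)"
proof -
  let ?g = "\<lambda>l. dist_G (x l) i"
  have step: "?g (Suc l) = Suc (?g l) \<or> ?g l = Suc (?g (Suc l))" if l: "l < m" for l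
  proof -
    have xs: "x (Suc l) \<in> nbrs G (x l)" "x l \<in> nbrs G (x (Suc l))"
      using nbr[OF l] nbrs_sym by blast+
    have V: "x l \<in> verts G" "x (Suc l) \<in> verts G" using nbrs_in_verts[OF xs(1)] by auto
    have "?g l \<noteq> ?g (Suc l)"
    proof
      assume eq: "?g l = ?g (Suc l)"
      show False
      proof (cases "x l = i")
        case True
        then have "x (Suc l) = i" using eq V i dist_self dist_eq_0_iff by metis
        then show False using True xs not_self_nbr by auto
      next
        case False
        obtain v where "v \<in> nbrs G (x l)" "Suc (dist_G v i) = ?g l"
          "\<And>v'. v' \<in> nbrs G (x l) \<Longrightarrow> v' \<noteq> v \<Longrightarrow> dist_G v' i = Suc (?g l)"
          using unique_closer_nbr[OF V(1) i False] by blast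
        then show False using xs(1) eq by (metis n_not_Suc_n)
      qed
    qed
    then show ?thesis using dist_nbr_le[OF xs(1) i] dist_nbr_le[OF xs(2) i] by auto
  qed
  have "\<not> (?g l < ?g (Suc l) \<and> ?g (Suc (Suc l)) < ?g (Suc l))" if l: "Suc l < m" for l
  proof
    assume "?g l < ?g (Suc l) \<and> ?g (Suc (Suc l)) < ?g (Suc l)"
    moreover have "x l \<in> nbrs G (x (Suc l))" "x (Suc (Suc l)) \<in> nbrs G (x (Suc l))"
      using nbr[of l] nbr[OF l] l nbrs_sym by auto
    ultimately have "x l = x (Suc (Suc l))"
      by (intro nonfarther_nbrs_eq[OF i]) auto
    then show False using inj_onD[OF inj, of l "Suc (Suc l)"] l by auto
  qed
  from no_local_max_imp_V_shape[of m ?g, OF step this] show ?thesis using that by blast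
qed

text \<open>Let \<open>x\<close> be a path of length \<open>\<delta>\<close>, let \<open>x k\<close> be its vertex nearest to \<open>i\<close>, and let \<open>c\<close> be the
  distance between \<open>x k\<close> and \<open>i\<close>. The distances to \<open>i\<close> are \<open>1, \<dots>, c\<close> along the connection from
  \<open>i\<close> to \<open>x k\<close>, and \<open>c + 1, \<dots>, c + k\<close> and \<open>c + 1, \<dots>, c + \<delta> - k\<close> on the two sides of \<open>x k\<close>. These
  vertices contribute \<open>\<delta>\<^sup>2 + 2 k (\<delta> - k) - c\<^sup>2\<close>. The ends of \<open>x\<close> are at distance at most \<open>\<delta>\<close> from
  \<open>i\<close>, so \<open>c\<close> is at most \<open>k\<close> and at most \<open>\<delta> - k\<close>, and the correction is nonnegative.\<close>
lemma sum_dist_deficit: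
  assumes i: "i \<in> verts G" and uv: "u \<in> verts G" "v \<in> verts G" "dist_G u v = \<delta>"
    and le: "\<And>a b. a \<in> verts G \<Longrightarrow> b \<in> verts G \<Longrightarrow> dist_G a b \<le> \<delta>"
  shows "(real \<delta>)\<^sup>2 \<le> (\<Sum>v\<in>verts G - {i}. 2 * real \<delta> + 1 - 2 * real (dist_G v i))"
proof -
  let ?f = "\<lambda>d. 2 * real \<delta> + 1 - 2 * real d"
  obtain x where x: "\<And>l. l < \<delta> \<Longrightarrow> x (Suc l) \<in> nbrs G (x l)"
    "\<And>l. l \<le> \<delta> \<Longrightarrow> x l \<in> verts G" "\<And>l. l \<le> \<delta> \<Longrightarrow> dist_G (x l) v = \<delta> - l"
    using geodesic[OF uv(1,2)] uv(3) by metis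
  have inj: "inj_on x {..\<delta>}"
  proof (rule inj_onI)
    fix a b assume "a \<in> {..\<delta>}" "b \<in> {..\<delta>}" "x a = x b"
    then show "a = b" using x(3)[of a] x(3)[of b] by simp
  qed
  obtain k where k: "k \<le> \<delta>" "\<And>l. l \<le> k \<Longrightarrow> dist_G (x l) i = dist_G (x k) i + (k - l)"
    "\<And>l. k \<le> l \<Longrightarrow> l \<le> \<delta> \<Longrightarrow> dist_G (x l) i = dist_G (x k) i + (l - k)"
    using dist_V_shape_on_geodesic[OF i x(1) inj] by blast
  define c where "c = dist_G (x k) i"
  have ck: "c + k \<le> \<delta>" "c \<le> k"
    using k(2)[of 0] k(3)[of \<delta>] le[OF x(2) i, of 0] le[OF x(2) i, of \<delta>] k(1) unfolding c_def by auto
  obtain y where y: "\<And>l. l \<le> c \<Longrightarrow> y l \<in> verts G" "\<And>l. l \<le> c \<Longrightarrow> dist_G (y l) i = c - l"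
    using geodesic[OF x(2)[OF k(1)] i] unfolding c_def by metis
  (* The index s of A is the distance to i, and that of B and C is the distance to x k. The vertex
     x k itself belongs to A if c > 0; if c = 0, it equals i and must not be counted. *)
  let ?A = "(\<lambda>s. y (c - s)) ` {1..c}" and ?B = "(\<lambda>s. x (k - s)) ` {1..k}"
    and ?C = "(\<lambda>s. x (k + s)) ` {1..\<delta> - k}"
  have dA: "dist_G (y (c - s)) i = s" if "s \<in> {1..c}" for s using y(2)[of "c - s"] that by auto
  have dB: "dist_G (x (k - s)) i = c + s" if "s \<in> {1..k}" for s
    using k(2)[of "k - s"] that by (auto simp: c_def)
  have dC: "dist_G (x (k + s)) i = c + s" if "s \<in> {1..\<delta> - k}" for s
    using k(3)[of "k + s"] that by (auto simp: c_def)
  have A: "1 \<le> dist_G w i \<and> dist_G w i \<le> c \<and> w \<in> verts G" if w: "w \<in> ?A" for w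
  proof -
    obtain s where s: "s \<in> {1..c}" "w = y (c - s)" using w by blast
    show ?thesis using dA[OF s(1)] s y(1)[of "c - s"] by auto
  qed
  have B: "c < dist_G w i \<and> w \<in> verts G" if w: "w \<in> ?B" for w
  proof -
    obtain s where s: "s \<in> {1..k}" "w = x (k - s)" using w by blast
    show ?thesis using dB[OF s(1)] s x(2)[of "k - s"] k(1) by auto
  qed
  have C: "c < dist_G w i \<and> w \<in> verts G" if w: "w \<in> ?C" for w
  proof -
    obtain s where s: "s \<in> {1..\<delta> - k}" "w = x (k + s)" using w by blast
    show ?thesis using dC[OF s(1)] s x(2)[of "k + s"] by auto
  qed
  have AB: "?A \<inter> ?B = {}" using A B leD by blast
  have AC: "?A \<inter> ?C = {}" using A C leD by blast
  have BC: "?B \<inter> ?C = {}"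
  proof -
    have "x (k - s) \<noteq> x (k + t)" if "s \<in> {1..k}" "t \<in> {1..\<delta> - k}" for s t
    proof
      have "k - s \<le> \<delta>" "k + t \<le> \<delta>" using that k(1) by auto
      moreover assume "x (k - s) = x (k + t)"
      ultimately have "k - s = k + t" using inj_onD[OF inj] by blast
      then show False using that by auto
    qed
    then show ?thesis by blast
  qed
  have sub: "?A \<union> ?B \<union> ?C \<subseteq> verts G - {i}"
  proof
    fix w assume "w \<in> ?A \<union> ?B \<union> ?C"
    then have "w \<in> verts G \<and> 0 < dist_G w i"
    proof (elim UnE)
      assume "w \<in> ?A"
      from A[OF this] show ?thesis by linarith
    next
      assume "w \<in> ?B"
      from B[OF this] show ?thesis by linarith
    next
      assume "w \<in> ?C"
      from C[OF this] show ?thesis by linarith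
    qed
    then show "w \<in> verts G - {i}" using dist_self[OF i] by auto
  qed
  have injA: "inj_on (\<lambda>s. y (c - s)) {1..c}"
    by (rule inj_on_inverseI[where g = "\<lambda>w. dist_G w i"]) (rule dA)
  have injB: "inj_on (\<lambda>s. x (k - s)) {1..k}"
    by (rule inj_on_inverseI[where g = "\<lambda>w. dist_G w i - c"]) (simp add: dB)
  have injC: "inj_on (\<lambda>s. x (k + s)) {1..\<delta> - k}"
    by (rule inj_on_inverseI[where g = "\<lambda>w. dist_G w i - c"]) (simp add: dC)
  have sA: "(\<Sum>v\<in>?A. ?f (dist_G v i)) = (\<Sum>s\<in>{1..c}. 2 * real \<delta> + 1 - 2 * real s)"
    by (rule sum.reindex_cong[where l = "\<lambda>s. y (c - s)"])
      (use injA in \<open>simp_all add: dA\<close>)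
  have sB: "(\<Sum>v\<in>?B. ?f (dist_G v i)) = (\<Sum>s\<in>{1..k}. (2 * real \<delta> - 2 * real c) + 1 - 2 * real s)"
    by (rule sum.reindex_cong[where l = "\<lambda>s. x (k - s)"])
      (use injB in \<open>simp_all add: dB\<close>)
  have sC: "(\<Sum>v\<in>?C. ?f (dist_G v i)) = (\<Sum>s\<in>{1..\<delta> - k}. (2 * real \<delta> - 2 * real c) + 1 - 2 * real s)"
    by (rule sum.reindex_cong[where l = "\<lambda>s. x (k + s)"])
      (use injC in \<open>simp_all add: dC\<close>)
  have "(\<Sum>v\<in>?A \<union> ?B \<union> ?C. ?f (dist_G v i))
      = (\<Sum>v\<in>?A \<union> ?B. ?f (dist_G v i)) + (\<Sum>v\<in>?C. ?f (dist_G v i))"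
  proof (rule sum.union_disjoint)
    show "(?A \<union> ?B) \<inter> ?C = {}" using AC BC by blast
  qed auto
  also have "(\<Sum>v\<in>?A \<union> ?B. ?f (dist_G v i))
      = (\<Sum>v\<in>?A. ?f (dist_G v i)) + (\<Sum>v\<in>?B. ?f (dist_G v i))"
    by (rule sum.union_disjoint[OF _ _ AB]) auto
  also have "\<dots> + (\<Sum>v\<in>?C. ?f (dist_G v i)) =
      (2 * real \<delta> * real c - (real c)\<^sup>2)
      + ((2 * real \<delta> - 2 * real c) * real k - (real k)\<^sup>2)
      + ((2 * real \<delta> - 2 * real c) * (real \<delta> - real k) - (real \<delta> - real k)\<^sup>2)"
    unfolding sA sB sC sum_odd_interval of_nat_diff[OF k(1)] ..
  also have "\<dots> = (real \<delta>)\<^sup>2 + (2 * real k * (real \<delta> - k) - (real c)\<^sup>2)"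
    by (simp add: algebra_simps power2_eq_square)
  also have "\<dots> \<ge> (real \<delta>)\<^sup>2"
  proof -
    have "real c * real c \<le> real k * (real \<delta> - k)"
      using ck by (intro mult_mono) auto
    moreover have "0 \<le> real k * (real \<delta> - k)" using k(1) by simp
    ultimately have "0 \<le> 2 * real k * (real \<delta> - k) - (real c)\<^sup>2" unfolding power2_eq_square by linarith
    then show ?thesis by simp
  qed
  finally have "(real \<delta>)\<^sup>2 \<le> (\<Sum>v\<in>?A \<union> ?B \<union> ?C. ?f (dist_G v i))" .
  also have "\<dots> \<le> (\<Sum>v\<in>verts G - {i}. ?f (dist_G v i))"
  proof (rule sum_mono2[OF _ sub])
    fix b assume "b \<in> verts G - {i} - (?A \<union> ?B \<union> ?C)"
    then have "dist_G b i \<le> \<delta>" using le[OF _ i] by blast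
    then show "0 \<le> ?f (dist_G b i)" by linarith
  qed simp
  finally show ?thesis .
qed

lemma sum_degree_dist_le:
  assumes w: "w \<in> verts G"
  defines "\<delta> \<equiv> graph_diameter G"
  shows "(\<Sum>v\<in>verts G. real (out_degree G v) * real (dist_G v w))
    \<le> 2 * real \<delta> * (real (card (verts G)) - 1) - (real \<delta>)\<^sup>2"
proof -
  obtain a b where "a \<in> verts G" "b \<in> verts G" "dist_G a b = \<delta>"
    using graph_diameter_attained unfolding \<delta>_def by blast
  then have "(real \<delta>)\<^sup>2 \<le> (\<Sum>v\<in>verts G - {w}. 2 * real \<delta> + 1 - 2 * real (dist_G v w))"
    using sum_dist_deficit[OF w] dist_le_diameter unfolding \<delta>_def by blast
  also have "\<dots> = (\<Sum>v\<in>verts G. 2 * real \<delta> + 1 - 2 * real (dist_G v w)) - (2 * real \<delta> + 1)"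
    using w by (simp add: sum_diff1 dist_self)
  also have "\<dots> = (2 * real \<delta> + 1) * (real (card (verts G)) - 1) - 2 * (\<Sum>v\<in>verts G. real (dist_G v w))"
    by (simp add: sum_subtractf sum_distrib_left algebra_simps)
  finally show ?thesis unfolding sum_degree_dist[OF w] by (simp add: algebra_simps)
qed

end

section \<open>Mean hitting times of the walk\<close>

text \<open>The tail-sum formula for the expectation, before integration.\<close>
lemma hitting_time_eq_suminf:
  "hitting_time j \<omega> = (\<Sum>n. if \<forall>t\<in>{1..n}. \<omega> t \<noteq> j then 1 else 0)"
proof (cases "\<exists>s\<ge>1. \<omega> s = j")
  case True
  define s where "s = (LEAST s. 1 \<le> s \<and> \<omega> s = j)"
  have s: "1 \<le> s" "\<omega> s = j" using LeastI_ex[of "\<lambda>s. 1 \<le> s \<and> \<omega> s = j"] True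
    unfolding s_def by auto
  have least: "s \<le> t" if "1 \<le> t" "\<omega> t = j" for t
    unfolding s_def using that by (intro Least_le) auto
  have hit: "hitting_time j \<omega> = of_nat s"
    unfolding hitting_time_def
  proof (rule antisym)
    show "(INF s\<in>{s. 1 \<le> s \<and> \<omega> s = j}. of_nat s) \<le> (of_nat s :: ennreal)"
      using s by (intro INF_lower) auto
    show "(of_nat s :: ennreal) \<le> (INF s\<in>{s. 1 \<le> s \<and> \<omega> s = j}. of_nat s)"
      using least by (intro INF_greatest) auto
  qed
  have "(\<forall>t\<in>{1..n}. \<omega> t \<noteq> j) \<longleftrightarrow> n < s" for n
    using s least by (metis atLeastAtMost_iff le_trans not_le)
  then have "(\<Sum>n. if \<forall>t\<in>{1..n}. \<omega> t \<noteq> j then 1 else 0) = (\<Sum>n. if n < s then 1 else (0::ennreal))"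
    by simp
  also have "\<dots> = (\<Sum>n\<in>{..<s}. if n < s then 1 else (0::ennreal))"
    by (rule suminf_finite) auto
  also have "\<dots> = of_nat s" by simp
  finally show ?thesis using hit by simp
next
  case False
  then have "{s. 1 \<le> s \<and> \<omega> s = j} = {}" by auto
  moreover have "(\<Sum>n. if \<forall>t\<in>{1..n}. \<omega> t \<noteq> j then 1 else (0::ennreal)) = (\<Sum>n. 1)"
    using False by (intro suminf_cong) auto
  moreover have "(\<Sum>n. 1 :: ennreal) = \<infinity>"
  proof -
    have "of_nat n \<le> (\<Sum>n. 1 :: ennreal)" for n
      using sum_le_suminf[of "\<lambda>_. 1 :: ennreal" "{..<n}"] by simp
    then show ?thesis
      using ennreal_Ex_less_of_nat[of "\<Sum>n. 1 :: ennreal"]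
      by (metis infinity_ennreal_def leD top.not_eq_extremum)
  qed
  ultimately show ?thesis by (simp add: hitting_time_def)
qed

lemma lists_Suc_length:
  "{xs. set xs \<subseteq> A \<and> length xs = Suc n} = (\<lambda>(v, xs). v # xs) ` (A \<times> {xs. set xs \<subseteq> A \<and> length xs = n})"
  by (auto simp: length_Suc_conv image_iff)

text \<open>The probability that the walk from \<open>u\<close> is in \<open>A\<close> at each of the times \<open>1, \<dots>, n\<close>.\<close>
primrec stay_prob :: "('a, 'b) pre_digraph \<Rightarrow> 'a set \<Rightarrow> nat \<Rightarrow> 'a \<Rightarrow> real" where
  "stay_prob G A 0 u = 1"
| "stay_prob G A (Suc n) u = (\<Sum>v\<in>A. transition G u v * stay_prob G A n v)"

lemma transition_nonneg: "0 \<le> transition G u v"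
  by (simp add: transition_def adjacency_def)

lemma stay_prob_nonneg: "0 \<le> stay_prob G A n u"
  by (induction n arbitrary: u) (auto intro!: sum_nonneg simp: transition_nonneg)

lemma stay_prob_eq_sum_lists:
  assumes "finite A"
  shows "stay_prob G A n u = (\<Sum>xs\<in>{xs. set xs \<subseteq> A \<and> length xs = n}.
    \<Prod>k<n. transition G ((u # xs) ! k) ((u # xs) ! Suc k))"
proof (induction n arbitrary: u)
  case 0
  have "{xs. set xs \<subseteq> A \<and> length xs = 0} = {[]}" by auto
  then show ?case by simp
next
  case (Suc n)
  have "(\<Sum>xs\<in>{xs. set xs \<subseteq> A \<and> length xs = Suc n}.
      \<Prod>k<Suc n. transition G ((u # xs) ! k) ((u # xs) ! Suc k))
    = (\<Sum>(v, xs)\<in>A \<times> {xs. set xs \<subseteq> A \<and> length xs = n}.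
      \<Prod>k<Suc n. transition G ((u # v # xs) ! k) ((u # v # xs) ! Suc k))"
    unfolding lists_Suc_length
    by (subst sum.reindex) (auto intro!: inj_onI sum.cong simp del: prod.lessThan_Suc)
  also have "\<dots> = (\<Sum>v\<in>A. \<Sum>xs\<in>{xs. set xs \<subseteq> A \<and> length xs = n}.
      transition G u v * (\<Prod>k<n. transition G ((v # xs) ! k) ((v # xs) ! Suc k)))"
    unfolding prod.lessThan_Suc_shift by (simp add: sum.cartesian_product)
  also have "\<dots> = stay_prob G A (Suc n) u"
    by (simp add: Suc.IH sum_distrib_left)
  finally show ?case by simp
qed

lemma space_walk_measure: "space (walk_measure G i) = UNIV"
  using sets_eq_imp_space_eq[OF sets_walk_measure] by (simp add: space_PiM)

lemma prob_space_walk_measure: "prob_space (walk_measure G i)"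
proof
  interpret Ionescu_Tulcea "walk_kernel G i" "\<lambda>_. count_space UNIV"
    by (rule Ionescu_Tulcea_walk)
  let ?X = "space (PiM {0::nat} (\<lambda>_. count_space (UNIV :: 'a set)))"
  have "space (walk_measure G i) = UNIV"
    by (rule space_walk_measure)
  also have "\<dots> = prod_emb UNIV (\<lambda>_. count_space (UNIV :: 'a set)) {0::nat} ?X"
    by (auto simp: prod_emb_def space_PiM)
  also have "emeasure (walk_measure G i) \<dots> = emeasure (CI {0}) ?X"
    unfolding walk_measure_def by (rule lim) auto
  also have "\<dots> = 1"
    using prob_space.emeasure_space_1[OF PF.prob_space_P[of "{0}"]] PF.space_P[of "{0}"] by simp
  finally show "emeasure (walk_measure G i) (space (walk_measure G i)) = 1" .
qed

lemma measurable_position [measurable]: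
  "(\<lambda>\<omega>. \<omega> s) \<in> measurable (walk_measure G i) (count_space UNIV)"
  unfolding measurable_cong_sets[OF sets_walk_measure refl]
  by (rule measurable_component_singleton) simp

locale positive_degrees = Digraph.graph G for G :: "('a, 'b) pre_digraph" (structure) +
  assumes out_degree_pos: "u \<in> verts G \<Longrightarrow> 0 < out_degree G u"
begin

text \<open>The event is a finite disjoint union of cylinders, one for each list of the next \<open>n\<close> positions.
  The starting point is part of the event because the cylinders fix it.\<close>
lemma emeasure_stay:
  assumes i: "i \<in> verts G" and A: "A \<subseteq> verts G"
  shows "emeasure (walk_measure G i) {\<omega>. \<omega> 0 = i \<and> (\<forall>t\<in>{1..n}. \<omega> t \<in> A)} = ennreal (stay_prob G A n i)"
proof -
  have fin: "finite A" using A finite_verts finite_subset by blast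
  let ?L = "{xs. set xs \<subseteq> A \<and> length xs = n}"
  let ?C = "\<lambda>xs. {\<omega>. \<forall>k\<le>n. \<omega> k = (i # xs) ! k}"
  have finL: "finite ?L" by (rule finite_lists_length_eq[OF fin])
  have eq: "{\<omega>. \<omega> 0 = i \<and> (\<forall>t\<in>{1..n}. \<omega> t \<in> A)} = (\<Union>xs\<in>?L. ?C xs)"
  proof (intro equalityI subsetI)
    fix \<omega> :: "nat \<Rightarrow> 'a" assume w: "\<omega> \<in> {\<omega>. \<omega> 0 = i \<and> (\<forall>t\<in>{1..n}. \<omega> t \<in> A)}"
    define xs where "xs = map (\<lambda>k. \<omega> (Suc k)) [0..<n]"
    have "\<omega> k = (i # xs) ! k" if "k \<le> n" for k
      using w that by (cases k) (auto simp: xs_def)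
    then have "\<omega> \<in> ?C xs" by blast
    moreover have "xs \<in> ?L" using w by (auto simp: xs_def)
    ultimately show "\<omega> \<in> (\<Union>xs\<in>?L. ?C xs)" by blast
  next
    fix \<omega> :: "nat \<Rightarrow> 'a" assume "\<omega> \<in> (\<Union>xs\<in>?L. ?C xs)"
    then obtain xs where xs: "set xs \<subseteq> A" "length xs = n" "\<And>k. k \<le> n \<Longrightarrow> \<omega> k = (i # xs) ! k"
      by blast
    have "\<omega> t \<in> A" if "t \<in> {1..n}" for t
    proof -
      have "(i # xs) ! t = xs ! (t - 1)" "t - 1 < length xs" using that xs(2) by (auto simp: nth_Cons')
      then show ?thesis using xs(1) xs(3)[of t] that nth_mem[of "t - 1" xs] by auto
    qed
    then show "\<omega> \<in> {\<omega>. \<omega> 0 = i \<and> (\<forall>t\<in>{1..n}. \<omega> t \<in> A)}" using xs(3)[of 0] by auto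
  qed
  have meas: "?C xs \<in> sets (walk_measure G i)" for xs
  proof -
    have "{\<omega> \<in> space (walk_measure G i). \<forall>k\<le>n. \<omega> k = (i # xs) ! k} \<in> sets (walk_measure G i)"
      by measurable
    then show ?thesis by (simp add: space_walk_measure)
  qed
  have disj: "disjoint_family_on ?C ?L"
  proof (unfold disjoint_family_on_def, intro ballI impI)
    fix xs ys assume L: "xs \<in> ?L" "ys \<in> ?L" "xs \<noteq> ys"
    then obtain k where "k < n" "xs ! k \<noteq> ys ! k" by (auto simp: list_eq_iff_nth_eq)
    then show "?C xs \<inter> ?C ys = {}" by (auto dest!: spec[of _ "Suc k"])
  qed
  have cyl: "emeasure (walk_measure G i) (?C xs)
      = ennreal (\<Prod>k<n. transition G ((i # xs) ! k) ((i # xs) ! Suc k))" if xs: "xs \<in> ?L" for xs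
  proof -
    have "(\<Prod>k<n. ennreal (pmf (step_pmf G ((i # xs) ! k)) ((i # xs) ! Suc k)))
        = (\<Prod>k<n. ennreal (transition G ((i # xs) ! k) ((i # xs) ! Suc k)))"
    proof (intro prod.cong refl)
      fix k assume "k \<in> {..<n}"
      then have "(i # xs) ! k \<in> set (i # xs)" using xs by (intro nth_mem) auto
      then have "(i # xs) ! k \<in> verts G" using xs i A by auto
      then show "ennreal (pmf (step_pmf G ((i # xs) ! k)) ((i # xs) ! Suc k))
          = ennreal (transition G ((i # xs) ! k) ((i # xs) ! Suc k))"
        using out_degree_pos pmf_step_pmf[OF graph_axioms] by simp
    qed
    then show ?thesis
      unfolding emeasure_walk_cylinder by (simp add: prod_ennreal transition_nonneg)
  qed
  have "emeasure (walk_measure G i) (\<Union>xs\<in>?L. ?C xs) = (\<Sum>xs\<in>?L. emeasure (walk_measure G i) (?C xs))"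
    using meas disj finL by (intro sum_emeasure[symmetric]) auto
  also have "\<dots> = (\<Sum>xs\<in>?L. ennreal (\<Prod>k<n. transition G ((i # xs) ! k) ((i # xs) ! Suc k)))"
    using cyl by (intro sum.cong) auto
  also have "\<dots> = ennreal (stay_prob G A n i)"
    unfolding stay_prob_eq_sum_lists[OF fin]
    by (intro sum_ennreal prod_nonneg) (auto simp: transition_nonneg)
  finally show ?thesis unfolding eq .
qed

lemma sum_transition:
  assumes "u \<in> verts G"
  shows "(\<Sum>v\<in>verts G. transition G u v * f v) = (\<Sum>v\<in>nbrs G u. f v) / real (out_degree G u)"
proof -
  have "(\<Sum>v\<in>verts G. transition G u v * f v)
      = (\<Sum>v\<in>nbrs G u. f v / real (out_degree G u))"
    by (rule sum.mono_neutral_cong_right)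
      (auto simp: nbrs_def transition_def adjacency_def)
  then show ?thesis by (simp add: sum_divide_distrib)
qed

lemma stay_prob_verts: "u \<in> verts G \<Longrightarrow> stay_prob G (verts G) n u = 1"
proof (induction n arbitrary: u)
  case (Suc n)
  then show ?case
    using sum_transition[OF Suc.prems, of "\<lambda>_. 1"] out_degree_pos[OF Suc.prems]
    by (simp add: card_nbrs)
qed simp

text \<open>Taking \<open>A\<close> to be all vertices in \<open>emeasure_stay\<close> shows that the walk almost surely starts at
  \<open>i\<close> and stays in the graph, so avoiding \<open>j\<close> and staying in \<open>verts G - {j}\<close> agree almost surely.\<close>
lemma emeasure_avoid:
  assumes i: "i \<in> verts G"
  shows "emeasure (walk_measure G i) {\<omega>. \<forall>t\<in>{1..n}. \<omega> t \<noteq> j} = ennreal (stay_prob G (verts G - {j}) n i)"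
proof -
  interpret prob_space "walk_measure G i" by (rule prob_space_walk_measure)
  have [measurable]: "Measurable.pred (walk_measure G i) (\<lambda>\<omega>. \<omega> t \<in> A)" for t A
    by (rule measurable_compose[OF measurable_position]) simp
  have meas: "Measurable.pred (walk_measure G i) (\<lambda>\<omega>. \<omega> 0 = i \<and> (\<forall>t\<in>{1..n}. \<omega> t \<in> A))" for A
    by measurable
  have "emeasure (walk_measure G i) {\<omega>. \<omega> 0 = i \<and> (\<forall>t\<in>{1..n}. \<omega> t \<in> verts G)} = 1"
    using emeasure_stay[OF i subset_refl] stay_prob_verts[OF i] by simp
  then have "prob {\<omega> \<in> space (walk_measure G i). \<omega> 0 = i \<and> (\<forall>t\<in>{1..n}. \<omega> t \<in> verts G)} = 1"
    by (simp add: emeasure_eq_measure space_walk_measure)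
  then have ae: "AE \<omega> in walk_measure G i. \<omega> 0 = i \<and> (\<forall>t\<in>{1..n}. \<omega> t \<in> verts G)"
    by (subst (asm) prob_Collect_eq_1) (use meas in \<open>simp_all add: pred_def\<close>)
  have "emeasure (walk_measure G i) {\<omega> \<in> space (walk_measure G i). \<forall>t\<in>{1..n}. \<omega> t \<noteq> j}
      = emeasure (walk_measure G i)
          {\<omega> \<in> space (walk_measure G i). \<omega> 0 = i \<and> (\<forall>t\<in>{1..n}. \<omega> t \<in> verts G - {j})}"
  proof (rule emeasure_eq_AE)
    show "AE \<omega> in walk_measure G i.
        (\<omega> \<in> {\<omega> \<in> space (walk_measure G i). \<forall>t\<in>{1..n}. \<omega> t \<noteq> j}) =
        (\<omega> \<in> {\<omega> \<in> space (walk_measure G i). \<omega> 0 = i \<and> (\<forall>t\<in>{1..n}. \<omega> t \<in> verts G - {j})})"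
      using ae by eventually_elim (auto simp: space_walk_measure)
  qed measurable
  then show ?thesis using emeasure_stay[OF i, of "verts G - {j}" n] by (simp add: space_walk_measure)
qed

lemma mean_hitting_time_eq_suminf:
  assumes i: "i \<in> verts G"
  shows "mean_hitting_time G i j = (\<Sum>n. ennreal (stay_prob G (verts G - {j}) n i))"
proof -
  have meas: "{\<omega>. \<forall>t\<in>{1..n}. \<omega> t \<noteq> j} \<in> sets (walk_measure G i)" for n :: nat
  proof -
    have "{\<omega> \<in> space (walk_measure G i). \<forall>t\<in>{1..n}. \<omega> t \<noteq> j} \<in> sets (walk_measure G i)"
      by measurable
    then show ?thesis by (simp add: space_walk_measure)
  qed
  have "hitting_time j \<omega> = (\<Sum>n. indicator {\<omega>. \<forall>t\<in>{1..n}. \<omega> t \<noteq> j} \<omega>)" for \<omega>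
    unfolding hitting_time_eq_suminf by (intro suminf_cong) (simp add: indicator_def)
  then have "mean_hitting_time G i j
      = (\<integral>\<^sup>+\<omega>. (\<Sum>n. indicator {\<omega>. \<forall>t\<in>{1..n}. \<omega> t \<noteq> j} \<omega>) \<partial>walk_measure G i)"
    by (simp add: mean_hitting_time_def)
  also have "\<dots> = (\<Sum>n. \<integral>\<^sup>+\<omega>. indicator {\<omega>. \<forall>t\<in>{1..n}. \<omega> t \<noteq> j} \<omega> \<partial>walk_measure G i)"
    using meas by (intro nn_integral_suminf) auto
  also have "\<dots> = (\<Sum>n. ennreal (stay_prob G (verts G - {j}) n i))"
    by (simp only: nn_integral_indicator[OF meas] emeasure_avoid[OF i])
  finally show ?thesis .
qed

text \<open>Iterating the first-step equation \<open>n\<close> times shows that \<open>h\<close> exceeds the \<open>n\<close>-th partial sum of the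
  avoidance probabilities by the expected value of \<open>h\<close> after \<open>n\<close> steps on the event that \<open>j\<close> has been
  avoided. This is at most the maximum of \<open>h\<close> times the \<open>n\<close>-th avoidance probability. As \<open>h\<close> bounds
  the partial sums, the series converges and its terms tend to 0, so the remainder vanishes.\<close>
lemma mean_hitting_time_eqI:
  assumes nonneg: "\<And>u. u \<in> verts G \<Longrightarrow> 0 \<le> h u"
    and step: "\<And>u. u \<in> verts G \<Longrightarrow> h u = 1 + (\<Sum>v\<in>verts G - {j}. transition G u v * h v)"
    and i: "i \<in> verts G"
  shows "mean_hitting_time G i j = ennreal (h i)"
proof -
  let ?A = "verts G - {j}"
  let ?S = "\<lambda>n u. \<Sum>m<n. stay_prob G ?A m u"
  have S_Suc: "?S (Suc n) u = 1 + (\<Sum>v\<in>?A. transition G u v * ?S n v)" for n u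
    by (subst sum.lessThan_Suc_shift) (simp add: sum_distrib_left sum.swap[of _ _ ?A])
  (* b only has to be some bound of h, which exists because the graph is finite. *)
  define b where "b = Max (h ` verts G)"
  have b: "h u \<le> b" if "u \<in> verts G" for u unfolding b_def using that by simp
  have rem: "0 \<le> h u - ?S n u \<and> h u - ?S n u \<le> b * stay_prob G ?A n u" if "u \<in> verts G" for n u
    using that
  proof (induction n arbitrary: u)
    case 0
    then show ?case using nonneg b by simp
  next
    case (Suc n)
    have eq: "h u - ?S (Suc n) u = (\<Sum>v\<in>?A. transition G u v * (h v - ?S n v))"
      unfolding S_Suc step[OF Suc.prems] by (simp add: right_diff_distrib sum_subtractf)
    have "0 \<le> (\<Sum>v\<in>?A. transition G u v * (h v - ?S n v))"
      using Suc.IH by (intro sum_nonneg mult_nonneg_nonneg) (auto simp: transition_nonneg)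
    moreover have "(\<Sum>v\<in>?A. transition G u v * (h v - ?S n v))
        \<le> (\<Sum>v\<in>?A. transition G u v * (b * stay_prob G ?A n v))"
      using Suc.IH by (intro sum_mono mult_left_mono) (auto simp: transition_nonneg)
    moreover have "\<dots> = b * stay_prob G ?A (Suc n) u"
      by (simp add: sum_distrib_left mult_ac)
    ultimately show ?case unfolding eq by simp
  qed
  have summ: "summable (\<lambda>n. stay_prob G ?A n i)"
    using rem[OF i] by (intro bounded_imp_summable[of _ "h i"])
      (auto simp: stay_prob_nonneg lessThan_Suc_atMost[symmetric] simp del: sum.lessThan_Suc)
  have "(\<lambda>n. h i - ?S n i) \<longlonglongrightarrow> 0"
  proof (rule tendsto_sandwich[OF _ _ tendsto_const])
    show "(\<lambda>n. b * stay_prob G ?A n i) \<longlonglongrightarrow> 0"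
      using tendsto_mult_left[OF summable_LIMSEQ_zero[OF summ], of b] by simp
  qed (use rem[OF i] in auto)
  then have "(\<lambda>n. h i - (h i - ?S n i)) \<longlonglongrightarrow> h i - 0"
    by (intro tendsto_diff tendsto_const)
  then have "(\<lambda>n. stay_prob G ?A n i) sums h i" by (simp add: sums_def)
  then show ?thesis
    unfolding mean_hitting_time_eq_suminf[OF i]
    by (rule suminf_ennreal_eq[OF stay_prob_nonneg])
qed

text \<open>Kac's formula. Averaging the first-step equation over \<open>w\<close> leaves every term with \<open>v \<noteq> j\<close>
  on both sides. As \<open>h\<close> does not involve \<open>w\<close>, one solution for each \<open>j\<close> shows that the stationary
  distribution is unique.\<close>
lemma stationary_times_return_time:
  assumes w: "is_stationary G w" and j: "j \<in> verts G"
    and step: "\<And>u. u \<in> verts G \<Longrightarrow> h u = 1 + (\<Sum>v\<in>verts G - {j}. transition G u v * h v)"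
  shows "w j * h j = (1 :: real)"
proof -
  have "(\<Sum>u\<in>verts G. w u * h u)
      = (\<Sum>u\<in>verts G. w u) + (\<Sum>u\<in>verts G. \<Sum>v\<in>verts G - {j}. w u * transition G u v * h v)"
    unfolding sum.distrib[symmetric] using step
    by (intro sum.cong refl) (simp add: distrib_left sum_distrib_left mult.assoc)
  also have "(\<Sum>u\<in>verts G. \<Sum>v\<in>verts G - {j}. w u * transition G u v * h v)
      = (\<Sum>v\<in>verts G - {j}. (\<Sum>u\<in>verts G. w u * transition G u v) * h v)"
    by (subst sum.swap) (simp add: sum_distrib_right)
  also have "\<dots> = (\<Sum>v\<in>verts G - {j}. w v * h v)"
    using w by (intro sum.cong refl) (simp add: is_stationary_def)
  also have "(\<Sum>u\<in>verts G. w u * h u) = w j * h j + (\<Sum>v\<in>verts G - {j}. w v * h v)"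
    using j by (simp add: sum.remove)
  finally show ?thesis using w by (simp add: is_stationary_def)
qed

end

section \<open>Kemeny's constant of a tree\<close>

context tree_graph
begin

definition degree_sum :: real where
  "degree_sum = (\<Sum>v\<in>verts G. real (out_degree G v))"

text \<open>The mean hitting time of \<open>j\<close> from \<open>u\<close> if \<open>u \<noteq> j\<close>. The weight of \<open>deg k\<close> is the number of
  edges that the paths from \<open>u\<close> to \<open>j\<close> and from \<open>k\<close> to \<open>j\<close> share. At \<open>u = j\<close> the formula gives 0,
  which is the boundary value that the first-step equations need.\<close>
definition tree_hitting_time :: "'a \<Rightarrow> 'a \<Rightarrow> real" where
  "tree_hitting_time j u = (\<Sum>k\<in>verts G. real (out_degree G k) *
    (real (dist_G u j) + real (dist_G j k) - real (dist_G u k))) / 2"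

lemma tree_hitting_time_nonneg:
  assumes "j \<in> verts G" "u \<in> verts G"
  shows "0 \<le> tree_hitting_time j u"
proof -
  have "real (dist_G u k) \<le> real (dist_G u j) + real (dist_G j k)" if "k \<in> verts G" for k
    using dist_triangle[OF assms(2,1) that] by linarith
  then show ?thesis unfolding tree_hitting_time_def by (auto intro!: sum_nonneg)
qed

lemma tree_hitting_time_self: "j \<in> verts G \<Longrightarrow> tree_hitting_time j j = 0"
  by (simp add: tree_hitting_time_def dist_self)

text \<open>The distance to \<open>j\<close> and the distance to \<open>k\<close> change by the same total amount over the neighbours
  of \<open>u\<close>, except that \<open>u = j\<close> and \<open>u = k\<close> each cause a correction of 2. The correction for \<open>k\<close>
  selects the summand \<open>k = u\<close>, the one for \<open>j\<close> sums all degrees.\<close>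
lemma sum_nbrs_tree_hitting_time:
  assumes u: "u \<in> verts G" and j: "j \<in> verts G"
  shows "(\<Sum>v\<in>nbrs G u. tree_hitting_time j v)
    = real (out_degree G u) * tree_hitting_time j u - real (out_degree G u) + (if u = j then degree_sum else 0)"
proof -
  let ?deg = "\<lambda>v. real (out_degree G v)"
  let ?S = "\<lambda>w. \<Sum>v\<in>nbrs G u. real (dist_G v w)"
  have "2 * (\<Sum>v\<in>nbrs G u. tree_hitting_time j v) = (\<Sum>k\<in>verts G. \<Sum>v\<in>nbrs G u.
      ?deg k * (real (dist_G v j) + real (dist_G j k) - real (dist_G v k)))"
    unfolding tree_hitting_time_def by (subst sum.swap) (simp add: sum_divide_distrib[symmetric])
  also have "\<dots> = (\<Sum>k\<in>verts G. ?deg k * (?S j + ?deg u * real (dist_G j k) - ?S k))"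
    by (simp add: sum_distrib_left[symmetric] sum.distrib sum_subtractf card_nbrs)
  also have "\<dots> = (\<Sum>k\<in>verts G.
      ?deg u * (?deg k * (real (dist_G u j) + real (dist_G j k) - real (dist_G u k)))
      + 2 * ((if u = j then ?deg k else 0) - (if u = k then ?deg k else 0)))"
    by (intro sum.cong refl) (simp add: sum_nbrs_dist_eq[OF u] j algebra_simps)
  also have "\<dots> = ?deg u * (2 * tree_hitting_time j u) + 2 * ((if u = j then degree_sum else 0) - ?deg u)"
    unfolding tree_hitting_time_def sum.distrib sum_distrib_left[symmetric] sum_subtractf degree_sum_def
    using u by simp
  finally show ?thesis by (simp add: algebra_simps split: if_splits)
qed

context
  assumes two_verts: "2 \<le> card (verts G)"
begin

lemma out_degree_pos_tree:
  assumes u: "u \<in> verts G"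
  shows "0 < out_degree G u"
proof -
  have "\<not> verts G \<subseteq> {u}" using two_verts card_mono[of "{u}" "verts G"] by auto
  then obtain w where "w \<in> verts G" "u \<noteq> w" by auto
  then obtain v where "v \<in> nbrs G u" using closer_nbr_exists[OF u] by blast
  then show ?thesis using finite_nbrs[of u] unfolding card_nbrs[symmetric] card_gt_0_iff by blast
qed

interpretation positive_degrees G
  by unfold_locales (rule out_degree_pos_tree)

lemma degree_sum_pos: "0 < degree_sum"
  unfolding degree_sum_def using sum_degrees two_verts by simp

text \<open>The mean return time replaces the value 0 at \<open>u = j\<close>, because hitting times count from time
  1 on.\<close>
definition passage_time :: "'a \<Rightarrow> 'a \<Rightarrow> real" where
  "passage_time j u = (if u = j then degree_sum / real (out_degree G j) else tree_hitting_time j u)"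

lemma passage_time_step:
  assumes u: "u \<in> verts G" and j: "j \<in> verts G"
  shows "passage_time j u = 1 + (\<Sum>v\<in>verts G - {j}. transition G u v * passage_time j v)"
proof -
  have "(\<Sum>v\<in>verts G - {j}. transition G u v * passage_time j v)
      = (\<Sum>v\<in>verts G. transition G u v * tree_hitting_time j v)"
    by (rule sum.mono_neutral_cong_left) (auto simp: passage_time_def tree_hitting_time_self[OF j])
  also have "\<dots> = (\<Sum>v\<in>nbrs G u. tree_hitting_time j v) / real (out_degree G u)"
    by (rule sum_transition[OF u])
  also have "\<dots> = passage_time j u - 1"
    unfolding sum_nbrs_tree_hitting_time[OF u j] using out_degree_pos[OF u] tree_hitting_time_self[OF j]
    by (auto simp: passage_time_def field_simps)
  finally show ?thesis by simp
qed

lemma passage_time_nonneg: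
  "j \<in> verts G \<Longrightarrow> u \<in> verts G \<Longrightarrow> 0 \<le> passage_time j u"
  using degree_sum_pos tree_hitting_time_nonneg by (auto simp: passage_time_def intro!: divide_nonneg_nonneg)

lemma mean_hitting_time_tree:
  assumes "i \<in> verts G" "j \<in> verts G"
  shows "mean_hitting_time G i j = ennreal (passage_time j i)"
  using assms by (intro mean_hitting_time_eqI passage_time_nonneg passage_time_step)

lemma stationary_tree:
  assumes j: "j \<in> verts G"
  shows "stationary G j = real (out_degree G j) / degree_sum"
proof -
  let ?w = "\<lambda>j. if j \<in> verts G then real (out_degree G j) / degree_sum else 0"
  have "is_stationary G ?w"
    unfolding is_stationary_def
  proof (intro conjI ballI allI impI)
    fix j assume j: "j \<in> verts G"
    have "(\<Sum>i\<in>verts G. ?w i * transition G i j) = (\<Sum>i\<in>verts G. if i \<in> nbrs G j then 1 / degree_sum else 0)"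
      using out_degree_pos nbrs_sym[of _ j]
      by (intro sum.cong refl) (auto simp: transition_def adjacency_def nbrs_def)
    also have "\<dots> = (\<Sum>i\<in>nbrs G j. 1 / degree_sum)"
      by (rule sum.mono_neutral_cong_right) (auto dest: nbrs_in_verts)
    also have "\<dots> = ?w j" using j by (simp add: card_nbrs)
    finally show "(\<Sum>i\<in>verts G. ?w i * transition G i j) = ?w j" .
    show "0 < ?w j" using j out_degree_pos[OF j] degree_sum_pos by simp
  next
    show "(\<Sum>j\<in>verts G. ?w j) = 1"
      using degree_sum_pos by (simp add: sum_divide_distrib[symmetric] degree_sum_def[symmetric])
  qed simp
  moreover have "w = ?w" if w: "is_stationary G w" for w
  proof
    fix k
    show "w k = ?w k"
    proof (cases "k \<in> verts G")
      case True
      have "w k * passage_time k k = 1"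
        by (rule stationary_times_return_time[OF w True]) (rule passage_time_step[OF _ True])
      then show ?thesis using True out_degree_pos[OF True] degree_sum_pos
        by (simp add: passage_time_def field_simps)
    next
      case False
      then show ?thesis using w by (simp add: is_stationary_def)
    qed
  qed
  ultimately have "stationary G = ?w" unfolding stationary_def by (rule the_equality)
  then show ?thesis using j by simp
qed

text \<open>In the double sum \<open>\<Sum>\<^sub>j\<^sub>,\<^sub>k d\<^sub>j d\<^sub>k (dist i j + dist j k - dist i k)\<close> the first and the last terms
  cancel by symmetry, which removes the dependence on the starting vertex \<open>i\<close>. The return time to
  \<open>i\<close> contributes the summand 1 that the definition of Kemeny's constant subtracts.\<close>
lemma kemeny_tree:
  "kemeny G = ereal ((\<Sum>j\<in>verts G. \<Sum>k\<in>verts G.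
    real (out_degree G j) * real (out_degree G k) * real (dist_G j k)) / (2 * degree_sum))"
    (is "_ = ereal ?K")
proof -
  let ?deg = "\<lambda>v. real (out_degree G v)"
  have main: "enn2ereal (\<Sum>j\<in>verts G. mean_hitting_time G i j * ennreal (stationary G j)) - 1 = ereal ?K"
    if i: "i \<in> verts G" for i
  proof -
    let ?W = "\<Sum>j\<in>verts G. \<Sum>k\<in>verts G. ?deg j * ?deg k * real (dist_G j k)"
    let ?D = "\<Sum>k\<in>verts G. ?deg k * real (dist_G i k)"
    have "(\<Sum>j\<in>verts G. mean_hitting_time G i j * ennreal (stationary G j))
        = (\<Sum>j\<in>verts G. ennreal (passage_time j i * (?deg j / degree_sum)))"
    proof (intro sum.cong refl)
      fix j assume j: "j \<in> verts G"
      show "mean_hitting_time G i j * ennreal (stationary G j) = ennreal (passage_time j i * (?deg j / degree_sum))"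
        unfolding mean_hitting_time_tree[OF i j] stationary_tree[OF j]
        by (rule ennreal_mult'[symmetric, OF passage_time_nonneg[OF j i]])
    qed
    also have "\<dots> = ennreal (\<Sum>j\<in>verts G. passage_time j i * (?deg j / degree_sum))"
      using passage_time_nonneg[OF _ i] degree_sum_pos by (intro sum_ennreal) auto
    also have "(\<Sum>j\<in>verts G. passage_time j i * (?deg j / degree_sum))
        = (\<Sum>j\<in>verts G. ?deg j * tree_hitting_time j i / degree_sum + (if i = j then 1 else 0))"
      using out_degree_pos degree_sum_pos
      by (intro sum.cong refl) (auto simp: passage_time_def tree_hitting_time_self)
    also have "\<dots> = (\<Sum>j\<in>verts G. ?deg j * tree_hitting_time j i) / degree_sum + 1"
      using i by (simp add: sum.distrib sum_divide_distrib)
    also have "(\<Sum>j\<in>verts G. ?deg j * tree_hitting_time j i) = (\<Sum>j\<in>verts G. \<Sum>k\<in>verts G.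
        ?deg k * (?deg j * real (dist_G i j)) + ?deg j * ?deg k * real (dist_G j k)
        - ?deg j * (?deg k * real (dist_G i k))) / 2"
      unfolding tree_hitting_time_def sum_divide_distrib sum_distrib_left
      by (intro sum.cong refl) (simp add: field_simps)
    also have "\<dots> = (degree_sum * ?D + ?W - degree_sum * ?D) / 2"
      by (simp add: sum.distrib sum_subtractf sum_distrib_left[symmetric] sum_distrib_right[symmetric] degree_sum_def)
    finally have eq: "(\<Sum>j\<in>verts G. mean_hitting_time G i j * ennreal (stationary G j)) = ennreal (?K + 1)"
      by simp
    have "0 \<le> ?K" using degree_sum_pos by (intro divide_nonneg_nonneg sum_nonneg) auto
    then have "enn2ereal (ennreal (?K + 1)) = ereal (?K + 1)" by (intro enn2ereal_ennreal) simp
    then show ?thesis unfolding eq by (simp add: one_ereal_def)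
  qed
  obtain i where "i \<in> verts G" using verts_nonempty by blast
  then have "(THE k. \<forall>i\<in>verts G.
      k = enn2ereal (\<Sum>j\<in>verts G. mean_hitting_time G i j * ennreal (stationary G j)) - 1) = ereal ?K"
    using main by (intro the_equality) auto
  then show ?thesis using two_verts by (simp add: kemeny_def)
qed

end

lemma kemeny_tree_le:
  defines "n \<equiv> card (verts G)" and "\<delta> \<equiv> graph_diameter G"
  shows "kemeny G \<le> ereal ((real n - 1) * real \<delta> - (real \<delta>)\<^sup>2 / 2)"
proof (cases "n = 1")
  case True
  then obtain u where "verts G = {u}" unfolding n_def by (auto simp: card_1_singleton_iff)
  then have "\<delta> = 0" using graph_diameter_attained dist_self unfolding \<delta>_def by auto
  then show ?thesis using True by (simp add: kemeny_def n_def)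
next
  case False
  have "n \<noteq> 0" using verts_nonempty by (simp add: n_def)
  with False have two: "2 \<le> card (verts G)" unfolding n_def by linarith
  let ?deg = "\<lambda>v. real (out_degree G v)"
  let ?B = "2 * real \<delta> * (real n - 1) - (real \<delta>)\<^sup>2"
  have "(\<Sum>j\<in>verts G. \<Sum>k\<in>verts G. ?deg j * ?deg k * real (dist_G j k))
      = (\<Sum>j\<in>verts G. ?deg j * (\<Sum>k\<in>verts G. ?deg k * real (dist_G k j)))"
    unfolding sum_distrib_left by (intro sum.cong refl) (simp add: dist_sym mult.assoc)
  also have "\<dots> \<le> (\<Sum>j\<in>verts G. ?deg j * ?B)"
    unfolding n_def \<delta>_def by (intro sum_mono mult_left_mono sum_degree_dist_le) auto
  also have "\<dots> = degree_sum * ?B" by (simp add: sum_distrib_right degree_sum_def)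
  finally have "(\<Sum>j\<in>verts G. \<Sum>k\<in>verts G. ?deg j * ?deg k * real (dist_G j k)) / (2 * degree_sum)
      \<le> ?B / 2"
    using degree_sum_pos[OF two] by (simp add: field_simps)
  then show ?thesis unfolding kemeny_tree[OF two] by (simp add: algebra_simps)
qed

end

theorem theorem5p1:
  fixes T :: "('a, 'b) pre_digraph" and n \<delta> :: nat
  assumes "undirected_tree T"
    and "card (verts T) = n"
    and "graph_diameter T = \<delta>"
  shows "kemeny T \<le> ereal (real n * real \<delta> - (real \<delta>)\<^sup>2 / 2)"
proof -
  interpret Digraph.graph T using assms(1) by (simp add: undirected_tree_def)
  interpret tree_graph T
    using assms(1) by unfold_locales (auto simp: undirected_tree_def)
  have "kemeny T \<le> ereal ((real n - 1) * real \<delta> - (real \<delta>)\<^sup>2 / 2)"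
    using kemeny_tree_le assms(2,3) by simp
  also have "\<dots> \<le> ereal (real n * real \<delta> - (real \<delta>)\<^sup>2 / 2)"
    by (simp add: algebra_simps)
  finally show ?thesis .
qed

end
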